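(* Let $S = \langle a, ah+d, ah+2d, \ldots, ah+kd\rangle$ be an extra-generalized arithmetical numerical semigroup, and let $F\subset\mathcal{C}(\mathbb{Z}_a)$ be the face containing $S$. Then $$\dim F = \begin{cases} a-1 & \text{if } k=a-1;\\ \lfloor \tfrac{a}{2}\rfloor & \text{if } k=a-2;\\ 2 & \text{if } 1<k<a-2;\\ 1 & \text{if } k=1.\end{cases}$$
   Context: A numerical semigroup is a subset $S \subseteq \mathbb{Z}_{\ge 0}$ containing $0$, closed under addition, with finite complement; $\langle n_1,\ldots,n_k\rangle$ denotes the set of all non-negative integer combinations of $n_1,\ldots,n_k$. For $m \in S$, $m>0$, the Apéry set $\operatorname{Ap}(S;m) = \{n \in S : n-m\notin S\}$ has exactly one element in each residue class modulo $m$; writing $\operatorname{Ap}(S;m) = \{0,a_1,\ldots,a_{m-1}\}$ with $a_i\equiv i \bmod m$, the Apéry tuple of $S$ (with respect to $m$) is $(a_1,\ldots,a_{m-1})$. For $m\ge 2$, the group cone $\mathcal{C}(\mathbb{Z}_m)\subset\mathbb{R}^{m-1}$ (coordinates indexed by $\mathbb{Z}_m\setminus\{0\}$) is the cone defined by the inequalities $x_i+x_j\ge x_{i+j}$ for $i,j\in\mathbb{Z}_m\setminus\{0\}$ with $i+j\ne 0$. Every Apéry tuple with respect to $m$ lies in it. A face $F$ of $\mathcal{C}(\mathbb{Z}_m)$ contains a numerical semigroup $S$ (with $m\in S$) if the Apéry tuple of $S$ lies in the relative interior of $F$. The dimension of a face is the dimension of its affine span. An extra-generalized arithmetical numerical semigroup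 is a numerical semigroup of the form $S = \langle a, ah+d, ah+2d,\ldots, ah+kd\rangle$ with $a,h,k \in \mathbb{Z}_{\ge 1}$ and $d\in\mathbb{Z}$ such that $k<a$, $\gcd(a,d)=1$, and $ah+kd>a$.
   Formalization: The generators a, ah+d, ..., ah+kd are additionally assumed to be minimal generators of S; without this the claim fails, e.g. a=3, h=4, d=-4, k=2 gives S=<3,8,4>=<3,4> with dim F = 1, not 2. *)

theory Defs
  imports "HOL-Analysis.Analysis" "Berlekamp_Zassenhaus.Finite_Field"
begin

subsection \<open>Numerical semigroups\<close>

text \<open>Semigroups are sets of integers rather than of natural numbers, so that the condition
  \<open>n - m \<notin> S\<close> in the Apery set is about true subtraction.\<close>

definition numerical_semigroup :: "int set \<Rightarrow> bool" where
  "numerical_semigroup S \<longleftrightarrow>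
     S \<subseteq> {0..} \<and> 0 \<in> S \<and> (\<forall>x\<in>S. \<forall>y\<in>S. x + y \<in> S) \<and> finite ({0..} - S)"

text \<open>Only meant for finite \<open>G\<close>.\<close>

definition generated_by :: "int set \<Rightarrow> int set" where
  "generated_by G = {n. \<exists>c :: int \<Rightarrow> nat. n = (\<Sum>g\<in>G. int (c g) * g)}"

definition minimally_generating :: "int set \<Rightarrow> bool" where
  "minimally_generating G \<longleftrightarrow> (\<forall>g\<in>G. g \<notin> generated_by (G - {g}))"

definition ega_generators :: "int \<Rightarrow> int \<Rightarrow> int \<Rightarrow> int \<Rightarrow> int set" where
  "ega_generators a h d k = insert a ((\<lambda>i. a * h + i * d) ` {1..k})"

text \<open>For \<open>d < 0\<close> these generators need not be minimal: \<open>a = 3\<close>, \<open>h = 4\<close>, \<open>d = -4\<close>, \<open>k = 2\<close>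
  gives \<open>3, 8, 4\<close>, which also generate the semigroup with parameters \<open>h = d = k = 1\<close>.
  So the conditions below do not determine \<open>k\<close> from the semigroup, and minimality of the
  generators is a separate condition.\<close>

definition extra_generalized_arithmetical ::
    "int \<Rightarrow> int \<Rightarrow> int \<Rightarrow> int \<Rightarrow> int set \<Rightarrow> bool" where
  "extra_generalized_arithmetical a h d k S \<longleftrightarrow>
     numerical_semigroup S \<and> S = generated_by (ega_generators a h d k) \<and>
     a \<ge> 1 \<and> h \<ge> 1 \<and> k \<ge> 1 \<and> k < a \<and> gcd a d = 1 \<and> a * h + k * d > a"

definition apery_set :: "int set \<Rightarrow> int \<Rightarrow> int set" where
  "apery_set S m = {n \<in> S. n - m \<notin> S}"

subsection \<open>The group cone of the integers modulo \<open>m\<close>\<close>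

text \<open>The modulus is \<open>m = CARD('m)\<close>, and \<open>'m mod_ring\<close> is the ring of integers modulo \<open>m\<close>.
  Class \<open>nontriv\<close> says \<open>m \<ge> 2\<close>, so the type below is the index set of the coordinates, and
  \<open>real ^ 'm nonzero_residue\<close> is real space of dimension \<open>m - 1\<close>.\<close>

typedef (overloaded) 'm nonzero_residue = "{i :: 'm::nontriv mod_ring. i \<noteq> 0}"
  by (rule exI[of _ 1]) simp

instance nonzero_residue :: (nontriv) finite
proof
  have "inj (Rep_nonzero_residue :: 'a nonzero_residue \<Rightarrow> 'a mod_ring)"
    by (simp add: inj_def Rep_nonzero_residue_inject)
  then show "finite (UNIV :: 'a nonzero_residue set)"
    by (rule finite_imageD[rotated]) simp
qed

lemma CARD_nonzero_residue: "CARD('m::nontriv nonzero_residue) = CARD('m) - 1"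
proof -
  interpret type_definition "Rep_nonzero_residue :: 'm nonzero_residue \<Rightarrow> _"
    Abs_nonzero_residue "{i :: 'm mod_ring. i \<noteq> 0}"
    by (rule type_definition_nonzero_residue)
  have "{i :: 'm mod_ring. i \<noteq> 0} = UNIV - {0}"
    by auto
  then show ?thesis
    using card by (simp add: card_Diff_singleton)
qed

definition group_cone :: "(real ^ 'm::nontriv nonzero_residue) set" where
  "group_cone = {x. \<forall>i j. Rep_nonzero_residue i + Rep_nonzero_residue j \<noteq> 0 \<longrightarrow>
     x $ i + x $ j \<ge> x $ Abs_nonzero_residue (Rep_nonzero_residue i + Rep_nonzero_residue j)}"

text \<open>Coordinate \<open>i\<close> is the unique element of the Apery set in the residue class \<open>i\<close>; the map
  \<open>of_int :: int \<Rightarrow> 'm mod_ring\<close> is reduction modulo \<open>m\<close>.\<close>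

definition apery_tuple :: "int set \<Rightarrow> real ^ 'm::nontriv nonzero_residue" where
  "apery_tuple S = (\<chi> i. real_of_int
     (THE n. n \<in> apery_set S (int CARD('m)) \<and> of_int n = Rep_nonzero_residue i))"

definition face_contains :: "(real ^ 'm::nontriv nonzero_residue) set \<Rightarrow> int set \<Rightarrow> bool" where
  "face_contains F S \<longleftrightarrow> F face_of group_cone \<and>
     numerical_semigroup S \<and> int CARD('m) \<in> S \<and> apery_tuple S \<in> rel_interior F"

end

theory Submission
  imports Defs
begin

text \<open>If \<open>x\<close> lies in the relative interior of a face \<open>F\<close> of a polyhedral cone, then \<open>F\<close> spans
  the solution space of the defining inequalities that are equations at \<open>x\<close>. For the
  semigroup \<open>S\<close>, minimality of the generators forces \<open>\<lfloor>a / k\<rfloor> h + d > 0\<close>, and therefore the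
  element of the Apery set in the residue class of \<open>j d\<close>, for \<open>0 < j < a\<close>, is
  \<open>\<lceil>j / k\<rceil> a h + j d\<close>. The equations at the Apery tuple are then those with \<open>i + j < a\<close> and
  \<open>\<lceil>i / k\<rceil> + \<lceil>j / k\<rceil> = \<lceil>(i + j) / k\<rceil>\<close>; they depend only on \<open>a\<close> and \<open>k\<close>, and the dimension
  of their solution space is found by exhibiting a set of free coordinates that determine the
  others.\<close>

section \<open>Faces of polyhedral cones\<close>

text \<open>The affine hull of \<open>F\<close> is the solution space of the equations tight at
  \<open>x\<close>. One inclusion uses that segments ending in \<open>x\<close> can be prolonged
  inside \<open>F\<close>; the other uses that small moves from \<open>x\<close> in a tight
  direction and its opposite stay in the cone, hence in \<open>F\<close> by the face
  property.\<close>

lemma aff_dim_face_polyhedral_cone: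
  fixes A :: "'p \<Rightarrow> 'n::euclidean_space"
  assumes P: "finite P"
    and F: "F face_of {y. \<forall>p\<in>P. 0 \<le> A p \<bullet> y}"
    and x: "x \<in> rel_interior F"
  shows "aff_dim F = int (dim {v. \<forall>p\<in>P. A p \<bullet> x = 0 \<longrightarrow> A p \<bullet> v = 0})"
proof -
  let ?C = "{y. \<forall>p\<in>P. 0 \<le> A p \<bullet> y}"
  let ?L = "{v. \<forall>p\<in>P. A p \<bullet> x = 0 \<longrightarrow> A p \<bullet> v = 0}"
  have "convex F" and FC: "F \<subseteq> ?C"
    using F by (auto simp: face_of_def)
  have xF: "x \<in> F"
    using x rel_interior_subset by blast
  have sub: "subspace ?L"
    by (auto simp: subspace_def inner_add_right)
  have "F \<subseteq> ?L"
  proof safe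
    fix y p assume y: "y \<in> F" and p: "p \<in> P" and tight: "A p \<bullet> x = 0"
    \<comment> \<open>Beyond \<open>x\<close> the weight \<open>1 - e\<close> of \<open>y\<close> is
      negative, so a positive value of \<open>A p\<close> at \<open>y\<close> would become negative
      at a point of \<open>F\<close>.\<close>
    obtain e :: real where e: "e > 1" "(1 - e) *\<^sub>R y + e *\<^sub>R x \<in> F"
      using convex_rel_interior_if[OF \<open>convex F\<close> x] y hull_subset[of F affine] by blast
    then have "0 \<le> A p \<bullet> ((1 - e) *\<^sub>R y + e *\<^sub>R x)"
      using FC p by blast
    then have "0 \<le> (1 - e) * (A p \<bullet> y)"
      using tight by (simp add: inner_add_right)
    moreover have "0 \<le> A p \<bullet> y"
      using FC y p by blast
    ultimately show "A p \<bullet> y = 0"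
      using \<open>e > 1\<close> by (simp add: zero_le_mult_iff)
  qed
  moreover have "?L \<subseteq> affine hull F"
  proof
    fix w assume w: "w \<in> ?L"
    define v where "v = w - x"
    have v: "v \<in> ?L"
      using w by (auto simp: v_def inner_diff_right)
    \<comment> \<open>Tight functionals vanish on \<open>v\<close> and the others have slack at
      \<open>x\<close>, so each admits all small \<open>e\<close>; finiteness of \<open>P\<close>
      gives a common one.\<close>
    have "\<forall>p\<in>P. \<forall>\<^sub>F e in at_right 0. \<bar>e * (A p \<bullet> v)\<bar> \<le> A p \<bullet> x"
    proof
      fix p assume p: "p \<in> P"
      show "\<forall>\<^sub>F e in at_right 0. \<bar>e * (A p \<bullet> v)\<bar> \<le> A p \<bullet> x"
      proof (cases "A p \<bullet> x = 0")
        case True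
        then show ?thesis using v p by simp
      next
        case False
        moreover have "0 \<le> A p \<bullet> x"
          using FC xF p by blast
        ultimately have pos: "0 < A p \<bullet> x"
          by simp
        have "((\<lambda>e. \<bar>e * (A p \<bullet> v)\<bar>) \<longlongrightarrow> \<bar>0 * (A p \<bullet> v)\<bar>) (at_right 0)"
          by (intro tendsto_intros)
        then have "\<forall>\<^sub>F e in at_right 0. \<bar>e * (A p \<bullet> v)\<bar> < A p \<bullet> x"
          using pos by (intro order_tendstoD) auto
        then show ?thesis
          by (rule eventually_mono) simp
      qed
    qed
    then have "\<forall>\<^sub>F e in at_right 0. \<forall>p\<in>P. \<bar>e * (A p \<bullet> v)\<bar> \<le> A p \<bullet> x"
      using P by (simp add: eventually_ball_finite_distrib)
    then have "\<forall>\<^sub>F e in at_right 0. 0 < e \<and> (\<forall>p\<in>P. \<bar>e * (A p \<bullet> v)\<bar> \<le> A p \<bullet> x)"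
      using eventually_at_right_less[of "0::real"] by eventually_elim simp
    then obtain e :: real where e: "e > 0" "\<forall>p\<in>P. \<bar>e * (A p \<bullet> v)\<bar> \<le> A p \<bullet> x"
      using eventually_happens'[of "at_right (0::real)"] trivial_limit_at_right_real by blast
    have "x + e *\<^sub>R v \<in> F"
    \<comment> \<open>The face property needs a nondegenerate segment around
      \<open>x\<close>.\<close>
    proof (cases "v = 0")
      case True
      then show ?thesis using xF by simp
    next
      case False
      have "x = midpoint (x - e *\<^sub>R v) (x + e *\<^sub>R v)"
        by (simp add: midpoint_def flip: scaleR_2)
      moreover have "x - e *\<^sub>R v \<noteq> x + e *\<^sub>R v"
      proof
        assume "x - e *\<^sub>R v = x + e *\<^sub>R v"
        then have "(x - e *\<^sub>R v) \<bullet> v = (x + e *\<^sub>R v) \<bullet> v"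
          by (rule arg_cong)
        then show False
          using False e(1) by (simp add: inner_diff_left inner_add_left)
      qed
      ultimately have "x \<in> open_segment (x - e *\<^sub>R v) (x + e *\<^sub>R v)"
        by (metis midpoint_in_open_segment)
      moreover have "x - e *\<^sub>R v \<in> ?C" "x + e *\<^sub>R v \<in> ?C"
        using e(2) by (auto simp: inner_add_right inner_diff_right abs_le_iff)
      ultimately show ?thesis
        using face_ofD[OF F] xF by blast
    qed
    then have "x + (1/e) *\<^sub>R ((x + e *\<^sub>R v) - x) \<in> affine hull F"
      using xF by (intro mem_affine_3_minus affine_affine_hull hull_inc)
    then show "w \<in> affine hull F"
      using e(1) by (simp add: v_def)
  qed
  ultimately have "affine hull F = ?L"
    by (metis (no_types, lifting) sub hull_minimal subset_antisym subspace_imp_affine)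
  then show ?thesis
    using aff_dim_affine_hull[of F] aff_dim_subspace[OF sub] by simp
qed

text \<open>Zeroing the coordinates outside \<open>J\<close> is injective on \<open>L\<close> by
  \<open>determined\<close> and maps \<open>L\<close> onto the whole coordinate subspace of
  \<open>J\<close> by \<open>free\<close>.\<close>

lemma dim_eq_card_coordinates:
  fixes L :: "(real ^ 'n) set"
  assumes L: "subspace L"
    and determined: "\<And>v. v \<in> L \<Longrightarrow> (\<And>i. i \<in> J \<Longrightarrow> v $ i = 0) \<Longrightarrow> v = 0"
    and free: "\<And>c. \<exists>v\<in>L. \<forall>i\<in>J. v $ i = c i"
  shows "dim L = card J"
proof -
  define f :: "real ^ 'n \<Rightarrow> real ^ 'n" where "f v = (\<chi> i. if i \<in> J then v $ i else 0)" for v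
  have "linear f"
    by (rule linearI) (auto simp: f_def vec_eq_iff)
  moreover have "inj_on f L"
  proof (rule inj_onI)
    fix v w assume vw: "v \<in> L" "w \<in> L" "f v = f w"
    then have "(v - w) $ i = 0" if "i \<in> J" for i
      using that unfolding f_def vec_eq_iff by (auto dest: spec[of _ i])
    then show "v = w"
      using determined[of "v - w"] subspace_diff[OF L] vw by auto
  qed
  ultimately have "dim (f ` L) = dim L"
    using L by (intro dim_image_eq) (auto simp: span_eq_iff[THEN iffD2])
  moreover have "f ` L = {v. \<forall>i. i \<notin> J \<longrightarrow> v $ i = 0}"
  proof (intro equalityI subsetI)
    fix w :: "real ^ 'n" assume w: "w \<in> {v. \<forall>i. i \<notin> J \<longrightarrow> v $ i = 0}"
    obtain v where "v \<in> L" "\<forall>i\<in>J. v $ i = w $ i"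
      using free by blast
    then show "w \<in> f ` L"
      using w by (intro image_eqI[of _ _ v]) (auto simp: f_def vec_eq_iff)
  qed (auto simp: f_def)
  ultimately show ?thesis
    using dim_substandard_cart[where ?'a = real, of J] by (simp add: dim_vec_eq)
qed

section \<open>Apery sets of extra-generalized arithmetical semigroups\<close>

lemma zero_in_generated_by: "0 \<in> generated_by G"
  unfolding generated_by_def by (auto intro: exI[of _ "\<lambda>_. 0"])

lemma add_in_generated_by:
  assumes "x \<in> generated_by G" "y \<in> generated_by G"
  shows "x + y \<in> generated_by G"
proof -
  obtain c c' :: "int \<Rightarrow> nat"
    where "x = (\<Sum>g\<in>G. int (c g) * g)" "y = (\<Sum>g\<in>G. int (c' g) * g)"
    using assms unfolding generated_by_def by blast
  then have "x + y = (\<Sum>g\<in>G. int (c g + c' g) * g)"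
    by (simp add: sum.distrib algebra_simps)
  then show ?thesis
    unfolding generated_by_def by (intro CollectI exI[of _ "\<lambda>g. c g + c' g"])
qed

lemma nat_mult_in_additive:
  fixes T :: "int set"
  assumes "0 \<in> T" "\<And>x y. x \<in> T \<Longrightarrow> y \<in> T \<Longrightarrow> x + y \<in> T" "g \<in> T"
  shows "int n * g \<in> T"
  by (induction n) (use assms in \<open>auto simp: algebra_simps\<close>)

lemma mult_in_generated_by:
  assumes "g \<in> generated_by G" "0 \<le> n"
  shows "n * g \<in> generated_by G"
  using nat_mult_in_additive[OF zero_in_generated_by add_in_generated_by assms(1), of "nat n"] assms(2)
  by simp

lemma generated_by_subset:
  assumes T: "0 \<in> T" "\<And>x y. x \<in> T \<Longrightarrow> y \<in> T \<Longrightarrow> x + y \<in> T" and "G \<subseteq> T"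
  shows "generated_by G \<subseteq> T"
proof
  fix n assume "n \<in> generated_by G"
  then obtain c :: "int \<Rightarrow> nat" where n: "n = (\<Sum>g\<in>G. int (c g) * g)"
    unfolding generated_by_def by blast
  have "(\<Sum>g\<in>G. int (c g) * g) \<in> T"
    using \<open>G \<subseteq> T\<close>
    by (induction G rule: infinite_finite_induct) (auto intro!: T nat_mult_in_additive[of T])
  then show "n \<in> T" using n by simp
qed

lemma generator_in_generated_by:
  assumes "finite G" "g \<in> G"
  shows "g \<in> generated_by G"
proof -
  have "g = (\<Sum>x\<in>G. int (if x = g then 1 else 0) * x)"
    using assms by (simp add: if_distrib[where f=int] if_distribR if_distrib sum.delta cong: if_cong)
  then show ?thesis
    unfolding generated_by_def by (intro CollectI exI[of _ "\<lambda>x. if x = g then 1 else 0"])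
qed

text \<open>Among nonnegative generators, a single copy of \<open>n\<close> already makes the sum at
  least \<open>n\<close>.\<close>

lemma generated_by_remove:
  assumes "finite G" "\<And>g. g \<in> G \<Longrightarrow> 0 \<le> g" "x \<in> generated_by G" "x < n" "n \<in> G"
  shows "x \<in> generated_by (G - {n})"
proof -
  obtain c :: "int \<Rightarrow> nat" where c: "x = (\<Sum>g\<in>G. int (c g) * g)"
    using assms(3) unfolding generated_by_def by blast
  also have "\<dots> = int (c n) * n + (\<Sum>g\<in>G - {n}. int (c g) * g)"
    using assms by (intro sum.remove)
  finally have x: "x = int (c n) * n + (\<Sum>g\<in>G - {n}. int (c g) * g)" .
  moreover have "0 \<le> (\<Sum>g\<in>G - {n}. int (c g) * g)"
    using assms(2) by (intro sum_nonneg) auto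
  ultimately have "int (c n) * n < 1 * n"
    using \<open>x < n\<close> by linarith
  then have "c n = 0"
    using assms(2)[OF \<open>n \<in> G\<close>] unfolding mult_less_cancel_right by simp
  then show ?thesis
    using x unfolding generated_by_def by auto
qed

text \<open>Both summands would be smaller than \<open>n\<close> and hence avoid it, so their sum
  would express \<open>n\<close> by the other generators.\<close>

lemma minimal_generator_indecomposable:
  assumes "finite G" "\<And>g. g \<in> G \<Longrightarrow> 0 < g" "minimally_generating G" "n \<in> G"
    and "x \<in> generated_by G" "y \<in> generated_by G" "0 < x" "0 < y"
  shows "x + y \<noteq> n"
proof
  assume n: "x + y = n"
  have "x \<in> generated_by (G - {n})" "y \<in> generated_by (G - {n})"
    using assms n by (auto intro!: generated_by_remove simp: less_imp_le)
  then have "n \<in> generated_by (G - {n})"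
    using add_in_generated_by n by blast
  then show False
    using assms unfolding minimally_generating_def by blast
qed

section \<open>Rounded-up quotients\<close>

definition ceil_div :: "int \<Rightarrow> int \<Rightarrow> int" where
  "ceil_div j k = \<lceil>real_of_int j / real_of_int k\<rceil>"

text \<open>The adjunction behind the estimates below. For \<open>0 \<le> j\<close> it makes
  \<open>ceil_div j k\<close> the least number of indices between 1 and \<open>k\<close> with total
  \<open>j\<close>.\<close>

lemma ceil_div_le_iff:
  assumes "k > 0"
  shows "ceil_div j k \<le> t \<longleftrightarrow> j \<le> k * t"
proof -
  have "ceil_div j k \<le> t \<longleftrightarrow> real_of_int j \<le> real_of_int (k * t)"
    using assms by (simp add: ceil_div_def ceiling_le_iff field_simps)
  then show ?thesis by linarith
qed

lemma ceil_div_upper: "k > 0 \<Longrightarrow> j \<le> k * ceil_div j k"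
  using ceil_div_le_iff[of k j "ceil_div j k"] by simp

lemma ceil_div_eqI:
  assumes "k > 0" "k * (t - 1) < j" "j \<le> k * t"
  shows "ceil_div j k = t"
  using assms ceil_div_le_iff[of k j t] ceil_div_le_iff[of k j "t - 1"] by simp

lemma ceil_div_eq_1: "1 \<le> j \<Longrightarrow> j \<le> k \<Longrightarrow> ceil_div j k = 1"
  by (rule ceil_div_eqI) auto

lemma ceil_div_add_self: "k > 0 \<Longrightarrow> ceil_div (j + k) k = ceil_div j k + 1"
  by (simp add: ceil_div_def add_divide_distrib)

lemma ceil_div_add_le: "k > 0 \<Longrightarrow> ceil_div (i + j) k \<le> ceil_div i k + ceil_div j k"
  using ceil_div_upper[of k i] ceil_div_upper[of k j] by (simp add: ceil_div_le_iff distrib_left)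

text \<open>Each index contributes at most \<open>k\<close> to the total, so raising the total by
  \<open>a\<close> costs at least \<open>f\<close> further indices.\<close>

lemma ceil_div_add_mult_ge:
  assumes "k > 0" "k * f \<le> a" "0 \<le> q"
  shows "ceil_div j k + q * f \<le> ceil_div (j + a * q) k"
proof -
  have "j + a * q \<le> k * ceil_div (j + a * q) k"
    using assms(1) by (rule ceil_div_upper)
  moreover have "(k * f) * q \<le> a * q"
    using assms by (intro mult_right_mono)
  ultimately have "j \<le> k * (ceil_div (j + a * q) k - q * f)"
    by (simp add: algebra_simps)
  then have "ceil_div j k \<le> ceil_div (j + a * q) k - q * f"
    unfolding ceil_div_le_iff[OF assms(1)] .
  then show ?thesis by simp
qed

section \<open>The semigroup given by minimal generators\<close>

locale minimal_ega =
  fixes a h d k :: int and S :: "int set"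
  assumes ega: "extra_generalized_arithmetical a h d k S"
    and minimal: "minimally_generating (ega_generators a h d k)"
begin

lemma semigroup: "numerical_semigroup S" and S: "S = generated_by (ega_generators a h d k)"
  and h: "h \<ge> 1" and k: "k \<ge> 1" "k < a" and coprime: "coprime a d"
  using ega by (auto simp: extra_generalized_arithmetical_def coprime_iff_gcd_eq_1)

lemma k_pos: "k > 0" and a: "a \<ge> 2"
  using k by auto

lemma mult_div_le: "k * (a div k) \<le> a"
  using mult_div_mod_eq[of k a] pos_mod_sign[OF k_pos, of a] by linarith

lemma add_in_S: "x \<in> S \<Longrightarrow> y \<in> S \<Longrightarrow> x + y \<in> S"
  using semigroup by (simp add: numerical_semigroup_def)

lemma finite_generators: "finite (ega_generators a h d k)"
  by (simp add: ega_generators_def)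

lemma generator_in_S: "g \<in> ega_generators a h d k \<Longrightarrow> g \<in> S"
  unfolding S by (rule generator_in_generated_by[OF finite_generators])

lemma a_in_S: "a \<in> S"
  by (rule generator_in_S) (simp add: ega_generators_def)

lemma mult_in_S: "x \<in> S \<Longrightarrow> 0 \<le> n \<Longrightarrow> n * x \<in> S"
  unfolding S by (rule mult_in_generated_by)

lemma generator_pos:
  assumes "g \<in> ega_generators a h d k"
  shows "0 < g"
proof -
  have "0 \<le> g"
    using generator_in_S[OF assms] semigroup by (auto simp: numerical_semigroup_def)
  moreover have "g \<noteq> 0"
    using minimal assms zero_in_generated_by by (auto simp: minimally_generating_def)
  ultimately show ?thesis by simp
qed

lemma progression_generator: "1 \<le> i \<Longrightarrow> i \<le> k \<Longrightarrow> a * h + i * d \<in> ega_generators a h d k"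
  by (auto simp: ega_generators_def)

text \<open>Here \<open>s\<close> is the total of the indices of \<open>t\<close> progression
  generators; all totals from \<open>t\<close> to \<open>k * t\<close> can be realized.\<close>

lemma in_S:
  assumes "0 \<le> t" "t \<le> s" "s \<le> k * t"
  shows "t * a * h + s * d \<in> S"
  using assms
proof (induction t arbitrary: s rule: int_ge_induct)
  case base
  then show ?case
    using semigroup by (simp add: numerical_semigroup_def)
next
  case (step t)
  \<comment> \<open>The smallest index that leaves a total of at most \<open>k * t\<close>, but at
    least 1, where the progression starts.\<close>
  define i where "i = max 1 (s - k * t)"
  have "t \<le> k * t"
    using step.hyps k by (simp add: mult_le_cancel_right1)
  then have i: "1 \<le> i" "i \<le> k" "t \<le> s - i" "s - i \<le> k * t"
    using step.prems k by (auto simp: i_def algebra_simps)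
  then have "(a * h + i * d) + (t * a * h + (s - i) * d) \<in> S"
    by (intro add_in_S generator_in_S progression_generator step.IH)
  then show ?case
    by (simp add: algebra_simps)
qed

text \<open>The converse of \<open>in_S\<close>, up to \<open>c\<close> copies of \<open>a\<close>:
  the numbers of this form include the generators and are closed under addition.\<close>

lemma S_cases:
  assumes "n \<in> S"
  obtains c t s where "0 \<le> c" "t \<le> s" "s \<le> k * t" "n = c * a + t * a * h + s * d" "0 \<le> t"
proof -
  let ?T = "{n. \<exists>c t s. 0 \<le> c \<and> 0 \<le> t \<and> t \<le> s \<and> s \<le> k * t \<and> n = c * a + t * a * h + s * d}"
  have "generated_by (ega_generators a h d k) \<subseteq> ?T"
  proof (rule generated_by_subset)
    show "0 \<in> ?T"
      by (auto intro!: exI[of _ 0])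
  next
    fix x y assume "x \<in> ?T" "y \<in> ?T"
    then obtain c t s c' t' s' where
      x: "0 \<le> c" "0 \<le> t" "t \<le> s" "s \<le> k * t" "x = c * a + t * a * h + s * d" and
      y: "0 \<le> c'" "0 \<le> t'" "t' \<le> s'" "s' \<le> k * t'" "y = c' * a + t' * a * h + s' * d"
      by blast
    have "x + y = (c + c') * a + (t + t') * a * h + (s + s') * d" "s + s' \<le> k * (t + t')"
      using x y by (simp_all add: algebra_simps)
    then show "x + y \<in> ?T"
      using x y by (intro CollectI exI[of _ "c + c'"] exI[of _ "t + t'"] exI[of _ "s + s'"]) auto
  next
    have "a \<in> ?T"
      by (intro CollectI exI[of _ 1] exI[of _ 0]) auto
    moreover have "a * h + i * d \<in> ?T" if "i \<in> {1..k}" for i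
      using that by (intro CollectI exI[of _ 0] exI[of _ 1] exI[of _ i]) auto
    ultimately show "ega_generators a h d k \<subseteq> ?T"
      unfolding ega_generators_def by blast
  qed
  then show ?thesis
    using assms that unfolding S by blast
qed

text \<open>Since \<open>a + 1 = (a + 1 - k f) + k f\<close> for \<open>f = a div k\<close>, the number
  \<open>(f + 1) a h + (a + 1) d\<close> is a sum of at least two generators. It is congruent to the
  generator \<open>a h + d\<close>, which would be redundant if \<open>f h + d\<close> were not positive.\<close>

lemma step_pos: "0 < (a div k) * h + d"
proof (rule ccontr)
  assume neg: "\<not> 0 < (a div k) * h + d"
  define f where "f = a div k"
  \<comment> \<open>This equals \<open>a mod k + 1\<close>, hence is an index between 1 and
    \<open>k\<close>.\<close>
  define i where "i = a + 1 - k * f"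
  have "f \<ge> 1"
    using k pos_imp_zdiv_pos_iff[of k a] by (simp add: f_def)
  have "k * f + a mod k = a"
    by (simp add: f_def)
  then have i: "1 \<le> i" "i \<le> k"
    using k pos_mod_bound[of k a] pos_mod_sign[of k a] unfolding i_def by linarith+
  define x where "x = a * h + i * d"
  \<comment> \<open>The last generator \<open>f\<close> times, with as many copies of
    \<open>a\<close> as bring \<open>x + y\<close> to exactly \<open>a * h + d\<close>; their number
    is nonnegative by \<open>neg\<close>.\<close>
  define y where "y = f * (a * h + k * d) + (- (f * h + d)) * a"
  have "x \<in> ega_generators a h d k" "a * h + k * d \<in> ega_generators a h d k"
    using i k by (auto simp: x_def intro!: progression_generator)
  moreover from this have "0 < f * (a * h + k * d)"
    using \<open>f \<ge> 1\<close> by (auto intro!: mult_pos_pos dest: generator_pos)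
  then have "0 < y"
    using neg a unfolding y_def f_def by (smt (verit) mult_nonneg_nonneg)
  moreover have "f * (a * h + k * d) \<in> S" "(- (f * h + d)) * a \<in> S"
    using \<open>f \<ge> 1\<close> neg k
    by (intro mult_in_S a_in_S; simp add: f_def generator_in_S progression_generator)+
  then have "y \<in> S"
    unfolding y_def by (rule add_in_S)
  ultimately have "x + y \<noteq> a * h + 1 * d"
    using finite_generators generator_pos minimal progression_generator[of 1] k generator_in_S
    unfolding S by (intro minimal_generator_indecomposable) auto
  then show False
    by (simp add: x_def y_def i_def algebra_simps)
qed

section \<open>The Apery set\<close>

definition apery :: "int \<Rightarrow> int" where
  "apery j = ceil_div j k * a * h + j * d"

lemma apery_in_S:
  assumes "0 \<le> j"
  shows "apery j \<in> S"
  unfolding apery_def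
proof (rule in_S)
  show "0 \<le> ceil_div j k"
    using assms ceil_div_le_iff[OF k_pos, of j "-1"] k by linarith
  have "1 * j \<le> k * j"
    using assms k by (intro mult_right_mono) auto
  then show "ceil_div j k \<le> j"
    by (simp add: ceil_div_le_iff[OF k_pos])
qed (rule ceil_div_upper[OF k_pos])

text \<open>By coprimality, the index total of such an \<open>n\<close> is \<open>j + a * q\<close>.
  Each of the \<open>q\<close> additional rounds needs at least \<open>a div k\<close> more
  generators and so adds at least \<open>a * ((a div k) * h + d)\<close>, which is positive by
  \<open>step_pos\<close>.\<close>

lemma apery_least:
  assumes "n \<in> S" "[n = j * d] (mod a)" "j < a"
  shows "apery j \<le> n"
proof -
  obtain c t s where n: "0 \<le> c" "t \<le> s" "s \<le> k * t" "n = c * a + t * a * h + s * d" "0 \<le> t"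
    using S_cases[OF assms(1)] .
  have "[s * d + a * (c + t * h) = j * d] (mod a)"
    using assms(2) n(4) by (simp add: algebra_simps)
  then have "[s * d = j * d] (mod a)"
    by (simp add: cong_def)
  then have "[s = j] (mod a)"
    using coprime by (simp add: cong_mult_rcancel coprime_commute)
  then obtain q where q: "s = j + a * q"
    by (metis cong_iff_lin cong_sym mult.commute)
  \<comment> \<open>A negative \<open>q\<close> would make the index total \<open>s\<close>
    negative, as \<open>j < a\<close>.\<close>
  have "0 \<le> q"
  proof (rule ccontr)
    assume "\<not> 0 \<le> q"
    then have "a * q \<le> a * (-1)"
      using a by (intro mult_left_mono) auto
    then show False
      using q n assms(3) by simp
  qed
  have "ceil_div j k + q * (a div k) \<le> ceil_div s k"
    unfolding q by (intro ceil_div_add_mult_ge k_pos mult_div_le \<open>0 \<le> q\<close>)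
  also have "\<dots> \<le> t"
    using n by (simp add: ceil_div_le_iff[OF k_pos])
  finally have "(ceil_div j k + q * (a div k)) * (a * h) \<le> t * (a * h)"
    using a h by (intro mult_right_mono) auto
  moreover have "0 \<le> q * a * ((a div k) * h + d)"
    using step_pos \<open>0 \<le> q\<close> a by simp
  moreover have "0 \<le> c * a"
    using n a by simp
  ultimately show ?thesis
    unfolding apery_def n(4) q by (simp add: algebra_simps)
qed

lemma apery_add_eq_iff:
  "apery i + apery j = apery (i + j) \<longleftrightarrow> ceil_div i k + ceil_div j k = ceil_div (i + j) k"
proof -
  have "apery i + apery j - apery (i + j) = (ceil_div i k + ceil_div j k - ceil_div (i + j) k) * (a * h)"
    by (simp add: apery_def algebra_simps)
  moreover have "a * h \<noteq> 0"
    using a h by simp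
  ultimately show ?thesis
    by (metis (no_types, lifting) eq_iff_diff_eq_0 mult_eq_0_iff)
qed

text \<open>Going from \<open>i + j - a\<close> to \<open>i + j\<close> costs at least
  \<open>a div k\<close> generators, and \<open>step_pos\<close> makes the gain strict. Hence
  inequalities whose index sum exceeds \<open>a\<close> are never tight.\<close>

lemma apery_wrap_less: "apery (i + j - a) < apery i + apery j"
proof -
  have "ceil_div (i + j - a) k + 1 * (a div k) \<le> ceil_div (i + j - a + a * 1) k"
    by (intro ceil_div_add_mult_ge k_pos mult_div_le) auto
  also have "\<dots> \<le> ceil_div i k + ceil_div j k"
    using ceil_div_add_le[OF k_pos, of i j] by simp
  finally have "(ceil_div (i + j - a) k + a div k) * (a * h) \<le> (ceil_div i k + ceil_div j k) * (a * h)"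
    using a h by (intro mult_right_mono) auto
  moreover have "0 < a * ((a div k) * h + d)"
    using step_pos a by simp
  ultimately show ?thesis
    by (simp add: apery_def algebra_simps)
qed

end

section \<open>The equations satisfied with equality by the Apery tuple\<close>

lemma of_int_mod_ring_eq_iff:
  "(of_int x :: 'm::nontriv mod_ring) = of_int y \<longleftrightarrow> [x = y] (mod int CARD('m))"
  unfolding cong_def by transfer simp

text \<open>Listing the classes as multiples of \<open>d\<close> turns their addition into addition
  of the indices \<open>j\<close>. If the class of \<open>j * d\<close> is zero, the value is
  unspecified.\<close>

definition residue_index :: "int \<Rightarrow> int \<Rightarrow> 'm::nontriv nonzero_residue" where
  "residue_index d j = Abs_nonzero_residue (of_int (j * d))"

lemma residue_index_cong:
  assumes "[i = j] (mod int CARD('m::nontriv))"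
  shows "(residue_index d i :: 'm nonzero_residue) = residue_index d j"
proof -
  have "(of_int (i * d) :: 'm mod_ring) = of_int (j * d)"
    unfolding of_int_mod_ring_eq_iff using assms by (rule cong_scalar_right)
  then show ?thesis
    by (simp add: residue_index_def)
qed

lemma of_int_mult_eq_0_iff:
  assumes "coprime (int CARD('m)) d"
  shows "(of_int (j * d) :: 'm::nontriv mod_ring) = 0 \<longleftrightarrow> int CARD('m) dvd j"
  using of_int_mod_ring_eq_iff[where ?'m = 'm, of "j * d" 0] assms
  by (simp add: cong_0_iff coprime_dvd_mult_left_iff del: of_int_mult)

lemma Rep_residue_index:
  assumes "coprime (int CARD('m)) d" "\<not> int CARD('m) dvd j"
  shows "Rep_nonzero_residue (residue_index d j :: 'm::nontriv nonzero_residue) = of_int (j * d)"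
  unfolding residue_index_def using of_int_mult_eq_0_iff[OF assms(1), of j] assms(2)
  by (intro Abs_nonzero_residue_inverse) simp

text \<open>Coprimality gives injectivity, and both sides have \<open>CARD('m) - 1\<close>
  elements.\<close>

lemma bij_residue_index:
  assumes "coprime (int CARD('m)) d"
  shows "bij_betw (residue_index d :: int \<Rightarrow> 'm::nontriv nonzero_residue) {1..<int CARD('m)} UNIV"
proof -
  have inj: "inj_on (residue_index d :: int \<Rightarrow> 'm nonzero_residue) {1..<int CARD('m)}"
  proof (rule inj_onI)
    fix i j assume ij: "i \<in> {1..<int CARD('m)}" "j \<in> {1..<int CARD('m)}"
      and eq: "residue_index d i = (residue_index d j :: 'm nonzero_residue)"
    have "\<not> int CARD('m) dvd i" "\<not> int CARD('m) dvd j"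
      using ij by (auto dest: zdvd_imp_le)
    then have "(of_int (i * d) :: 'm mod_ring) = of_int (j * d)"
      using arg_cong[OF eq, of Rep_nonzero_residue] Rep_residue_index[OF assms] by metis
    then have "[i = j] (mod int CARD('m))"
      using assms unfolding of_int_mod_ring_eq_iff
      by (simp add: cong_mult_rcancel coprime_commute)
    then show "i = j"
      using ij by (intro cong_less_imp_eq_int) auto
  qed
  then have "card (residue_index d ` {1..<int CARD('m)} :: 'm nonzero_residue set)
      = CARD('m nonzero_residue)"
    by (simp add: card_image CARD_nonzero_residue nat_diff_distrib)
  then have "residue_index d ` {1..<int CARD('m)} = (UNIV :: 'm nonzero_residue set)"
    by (intro card_eq_UNIV_imp_eq_UNIV) auto
  with inj show ?thesis
    by (simp add: bij_betw_def)
qed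

text \<open>Adding multiples of the modulus stays in \<open>S\<close>, so only the least element of
  a class leaves \<open>S\<close> when the modulus is subtracted.\<close>

lemma apery_tuple_nth_eqI:
  fixes i :: "'m::nontriv nonzero_residue"
  assumes S: "numerical_semigroup S" "int CARD('m) \<in> S"
    and n: "n \<in> S" "of_int n = Rep_nonzero_residue i"
    and least: "\<And>n'. n' \<in> S \<Longrightarrow> [n' = n] (mod int CARD('m)) \<Longrightarrow> n \<le> n'"
  shows "apery_tuple S $ i = of_int n"
proof -
  have "(THE n. n \<in> apery_set S (int CARD('m)) \<and> of_int n = Rep_nonzero_residue i) = n"
  proof (rule the_equality)
    have "n - int CARD('m) \<notin> S"
      using least[of "n - int CARD('m)"] by (auto simp: cong_iff_dvd_diff)
    then show "n \<in> apery_set S (int CARD('m)) \<and> of_int n = Rep_nonzero_residue i"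
      using n by (simp add: apery_set_def)
  next
    fix n' assume n': "n' \<in> apery_set S (int CARD('m)) \<and> of_int n' = Rep_nonzero_residue i"
    then have cong: "[n' = n] (mod int CARD('m))"
      using n(2) by (simp flip: of_int_mod_ring_eq_iff)
    then have "n \<le> n'"
      using n' by (intro least) (auto simp: apery_set_def)
    moreover obtain q where "n' = n + int CARD('m) * q"
      using cong_sym[OF cong] by (auto simp: cong_iff_lin mult.commute)
    ultimately have q: "n' = n + q * int CARD('m)" "0 \<le> q"
      by (auto simp: zero_le_mult_iff mult.commute)
    have "q = 0"
    proof (rule ccontr)
      assume "q \<noteq> 0"
      have "int (nat (q - 1)) * int CARD('m) \<in> S"
        using S by (intro nat_mult_in_additive) (auto simp: numerical_semigroup_def)
      then have "n + (q - 1) * int CARD('m) \<in> S"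
        using S(1) n(1) \<open>q \<noteq> 0\<close> \<open>0 \<le> q\<close> by (simp add: numerical_semigroup_def)
      then show False
        using n' unfolding q(1) by (simp add: apery_set_def algebra_simps)
    qed
    then show "n' = n"
      using q by simp
  qed
  then show ?thesis
    by (simp add: apery_tuple_def)
qed

text \<open>The tight equations in the coordinates \<open>residue_index d j\<close>. The function
  \<open>g\<close> stands for a vector; only its values from 1 to \<open>a - 1\<close>
  enter.\<close>

definition ceil_additive :: "int \<Rightarrow> int \<Rightarrow> (int \<Rightarrow> real) \<Rightarrow> bool" where
  "ceil_additive a k g \<longleftrightarrow> (\<forall>i j. 1 \<le> i \<longrightarrow> 1 \<le> j \<longrightarrow> i + j < a \<longrightarrow>
     ceil_div i k + ceil_div j k = ceil_div (i + j) k \<longrightarrow> g i + g j = g (i + j))"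

section \<open>Tight inequalities at the Apery tuple\<close>

context minimal_ega
begin

lemma apery_tuple_residue_index:
  assumes a_card: "a = int CARD('m::nontriv)" and j: "1 \<le> j" "j < a"
  shows "apery_tuple S $ (residue_index d j :: 'm nonzero_residue) = of_int (apery j)"
proof (rule apery_tuple_nth_eqI)
  have "\<not> a dvd j"
    using j by (auto dest: zdvd_imp_le)
  then have "Rep_nonzero_residue (residue_index d j :: 'm nonzero_residue) = of_int (j * d)"
    using coprime by (intro Rep_residue_index) (auto simp: a_card)
  moreover have cong: "[apery j = j * d] (mod a)"
    by (simp add: apery_def cong_iff_dvd_diff)
  ultimately show "of_int (apery j) = Rep_nonzero_residue (residue_index d j :: 'm nonzero_residue)"
    using of_int_mod_ring_eq_iff a_card by metis
  show "apery j \<le> n'" if "n' \<in> S" "[n' = apery j] (mod int CARD('m))" for n'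
    using that j cong by (intro apery_least) (auto simp: a_card intro: cong_trans)
qed (use a_in_S semigroup j a_card apery_in_S in auto)

lemma aff_dim_face_containing:
  fixes F :: "(real ^ 'm::nontriv nonzero_residue) set"
  assumes a_card: "a = int CARD('m)" and F: "face_contains F S"
  shows "aff_dim F =
    int (dim {v :: real ^ 'm nonzero_residue. ceil_additive a k (\<lambda>j. v $ residue_index d j)})"
proof -
  let ?R = "Rep_nonzero_residue :: 'm nonzero_residue \<Rightarrow> _"
  let ?\<phi> = "residue_index d :: int \<Rightarrow> 'm nonzero_residue"
  define x :: "real ^ 'm nonzero_residue" where "x = apery_tuple S"
  define P where "P = {(i, j). ?R i + ?R j \<noteq> 0}"
  \<comment> \<open>Off \<open>P\<close> the sum is zero and \<open>s\<close> is unspecified, but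
    only pairs in \<open>P\<close> give inequalities of the cone.\<close>
  define s where "s = (\<lambda>(i, j). Abs_nonzero_residue (?R i + ?R j))"
  define A :: "_ \<Rightarrow> real ^ 'm nonzero_residue" where
    "A p = axis (fst p) 1 + axis (snd p) 1 - axis (s p) 1" for p
  have A: "A p \<bullet> v = v $ fst p + v $ snd p - v $ s p" for p v
    by (simp add: A_def inner_add_left inner_diff_left inner_axis')
  have "group_cone = {y. \<forall>p\<in>P. 0 \<le> A p \<bullet> y}"
    by (auto simp: group_cone_def P_def A s_def)
  then have "aff_dim F = int (dim {v. \<forall>p\<in>P. A p \<bullet> x = 0 \<longrightarrow> A p \<bullet> v = 0})"
    using F by (intro aff_dim_face_polyhedral_cone) (auto simp: face_contains_def x_def)
  also have "{v. \<forall>p\<in>P. A p \<bullet> x = 0 \<longrightarrow> A p \<bullet> v = 0} =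
      {v. ceil_additive a k (\<lambda>j. v $ residue_index d j)}"
  proof (rule Collect_cong)
    fix v :: "real ^ 'm nonzero_residue"
    have bij: "bij_betw ?\<phi> {1..<a} UNIV"
      using bij_residue_index[where ?'m = 'm] coprime by (simp add: a_card)
    have Rep: "?R (?\<phi> j) = of_int (j * d)" if "1 \<le> j" "j < a" for j
      using that coprime by (intro Rep_residue_index) (auto simp: a_card dest: zdvd_imp_le)
    have s: "s (?\<phi> i, ?\<phi> j) = ?\<phi> (i + j)" if "1 \<le> i" "i < a" "1 \<le> j" "j < a" for i j
      using that by (simp add: s_def Rep) (simp add: residue_index_def distrib_right)
    have P: "(?\<phi> i, ?\<phi> j) \<in> P \<longleftrightarrow> i + j \<noteq> a" if "1 \<le> i" "i < a" "1 \<le> j" "j < a" for i j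
    proof -
      have "a dvd i + j \<longleftrightarrow> i + j = a"
      proof
        assume "a dvd i + j"
        then obtain q where q: "i + j = a * q" ..
        have "a * 0 < a * q" "a * q < a * 2"
          using that unfolding q[symmetric] by linarith+
        moreover have "0 < a"
          using a by simp
        ultimately have "0 < q" "q < 2"
          using mult_less_cancel_left_pos[of a] by blast+
        then have "q = 1" by simp
        then show "i + j = a" using q by simp
      qed simp
      then show ?thesis
        using of_int_mult_eq_0_iff[where ?'m = 'm, of d "i + j"] coprime that
        by (simp add: P_def Rep a_card distrib_right)
    qed
    have x: "x $ ?\<phi> j = of_int (apery j)" if "1 \<le> j" "j < a" for j
      unfolding x_def using that by (rule apery_tuple_residue_index[OF a_card])
    have all_index: "(\<forall>I. Q I) \<longleftrightarrow> (\<forall>i\<in>{1..<a}. Q (?\<phi> i))" for Q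
    proof -
      have "(\<forall>I. Q I) \<longleftrightarrow> (\<forall>I\<in>?\<phi> ` {1..<a}. Q I)"
        unfolding bij_betw_imp_surj_on[OF bij] by simp
      then show ?thesis by simp
    qed
    have "(\<forall>p\<in>P. A p \<bullet> x = 0 \<longrightarrow> A p \<bullet> v = 0) \<longleftrightarrow>
        (\<forall>I J. (I, J) \<in> P \<longrightarrow> A (I, J) \<bullet> x = 0 \<longrightarrow> A (I, J) \<bullet> v = 0)"
      by auto
    also have "\<dots> \<longleftrightarrow> (\<forall>i\<in>{1..<a}. \<forall>j\<in>{1..<a}. (?\<phi> i, ?\<phi> j) \<in> P \<longrightarrow>
        A (?\<phi> i, ?\<phi> j) \<bullet> x = 0 \<longrightarrow> A (?\<phi> i, ?\<phi> j) \<bullet> v = 0)"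
      unfolding all_index ..
    also have "\<dots> \<longleftrightarrow> ceil_additive a k (\<lambda>j. v $ ?\<phi> j)" (is "?lhs \<longleftrightarrow> _")
    proof -
      \<comment> \<open>An index sum below \<open>a\<close> is tight exactly when the ceilings add
        up; the sum \<open>a\<close> is the zero class and gives no inequality; a larger sum wraps
        around and is strict.\<close>
      have tight: "((?\<phi> i, ?\<phi> j) \<in> P \<and> A (?\<phi> i, ?\<phi> j) \<bullet> x = 0) \<longleftrightarrow>
          i + j < a \<and> ceil_div i k + ceil_div j k = ceil_div (i + j) k"
        if ij: "1 \<le> i" "i < a" "1 \<le> j" "j < a" for i j
      proof -
        consider "i + j < a" | "i + j = a" | "i + j > a" by linarith
        then show ?thesis
        proof cases
          case 1
          then have "A (?\<phi> i, ?\<phi> j) \<bullet> x = of_int (apery i + apery j - apery (i + j))"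
            using ij by (simp add: A s x)
          then have "A (?\<phi> i, ?\<phi> j) \<bullet> x = 0 \<longleftrightarrow> apery i + apery j = apery (i + j)"
            by (simp only: of_int_eq_0_iff) simp
          then show ?thesis
            using 1 ij by (simp add: P apery_add_eq_iff)
        next
          case 3
          have "?\<phi> (i + j) = ?\<phi> (i + j - a)"
            by (rule residue_index_cong) (simp add: a_card cong_iff_dvd_diff)
          then have "A (?\<phi> i, ?\<phi> j) \<bullet> x = of_int (apery i + apery j - apery (i + j - a))"
            using ij 3 by (simp add: A s x)
          then show ?thesis
            using 3 apery_wrap_less[of i j] by simp
        qed (use ij P in auto)
      qed
      have lin: "A (?\<phi> i, ?\<phi> j) \<bullet> v = 0 \<longleftrightarrow> v $ ?\<phi> i + v $ ?\<phi> j = v $ ?\<phi> (i + j)"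
        if "1 \<le> i" "i < a" "1 \<le> j" "j < a" for i j
        using that by (simp add: A s)
      have "((?\<phi> i, ?\<phi> j) \<in> P \<longrightarrow> A (?\<phi> i, ?\<phi> j) \<bullet> x = 0 \<longrightarrow> A (?\<phi> i, ?\<phi> j) \<bullet> v = 0) \<longleftrightarrow>
          (i + j < a \<longrightarrow> ceil_div i k + ceil_div j k = ceil_div (i + j) k \<longrightarrow>
            v $ ?\<phi> i + v $ ?\<phi> j = v $ ?\<phi> (i + j))"
        if "i \<in> {1..<a}" "j \<in> {1..<a}" for i j
        using tight[of i j] lin[of i j] that unfolding atLeastLessThan_iff by blast
      then have "?lhs \<longleftrightarrow> (\<forall>i\<in>{1..<a}. \<forall>j\<in>{1..<a}. i + j < a \<longrightarrow>
          ceil_div i k + ceil_div j k = ceil_div (i + j) k \<longrightarrow>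
            v $ ?\<phi> i + v $ ?\<phi> j = v $ ?\<phi> (i + j))"
        by (intro ball_cong refl)
      then show ?thesis
        unfolding ceil_additive_def by fastforce
    qed
    finally show "(\<forall>p\<in>P. A p \<bullet> x = 0 \<longrightarrow> A p \<bullet> v = 0) \<longleftrightarrow> ceil_additive a k (\<lambda>j. v $ ?\<phi> j)" .
  qed
  finally show ?thesis .
qed

text \<open>Reduces each case to functions on the integers: the coordinates indexed by
  \<open>I\<close> must be free and determine the rest, and \<open>residue_index d\<close> is
  injective on \<open>I\<close>.\<close>

lemma aff_dim_face_eq_card:
  fixes F :: "(real ^ 'm::nontriv nonzero_residue) set"
  assumes a_card: "a = int CARD('m)" and F: "face_contains F S" and I: "I \<subseteq> {1..<a}"
    and determined: "\<And>g j. ceil_additive a k g \<Longrightarrow> (\<And>i. i \<in> I \<Longrightarrow> g i = 0) \<Longrightarrow>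
      1 \<le> j \<Longrightarrow> j < a \<Longrightarrow> g j = 0"
    and free: "\<And>c. \<exists>g. ceil_additive a k g \<and> (\<forall>i\<in>I. g i = c i)"
  shows "aff_dim F = int (card I)"
proof -
  let ?\<phi> = "residue_index d :: int \<Rightarrow> 'm nonzero_residue"
  let ?L = "{v :: real ^ 'm nonzero_residue. ceil_additive a k (\<lambda>j. v $ ?\<phi> j)}"
  have bij: "bij_betw ?\<phi> {1..<a} UNIV"
    using bij_residue_index[where ?'m = 'm] coprime by (simp add: a_card)
  have "dim ?L = card (?\<phi> ` I)"
  proof (rule dim_eq_card_coordinates)
    have "v + w \<in> ?L" if "v \<in> ?L" "w \<in> ?L" for v w
      unfolding mem_Collect_eq ceil_additive_def
    proof (intro allI impI)
      fix i j
      assume "1 \<le> i" "1 \<le> j" "i + j < a" "ceil_div i k + ceil_div j k = ceil_div (i + j) k"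
      then have "u $ ?\<phi> i + u $ ?\<phi> j = u $ ?\<phi> (i + j)" if "u \<in> {v, w}" for u
        using that \<open>v \<in> ?L\<close> \<open>w \<in> ?L\<close> unfolding ceil_additive_def by blast
      from this[of v] this[of w]
      show "(v + w) $ ?\<phi> i + (v + w) $ ?\<phi> j = (v + w) $ ?\<phi> (i + j)"
        by simp
    qed
    moreover have "c *\<^sub>R v \<in> ?L" if "v \<in> ?L" for c v
      using that by (auto simp: ceil_additive_def simp flip: distrib_left)
    ultimately show "subspace ?L"
      by (intro subspaceI) (auto simp: ceil_additive_def)
    show "v = 0" if v: "v \<in> ?L" and 0: "\<And>i. i \<in> ?\<phi> ` I \<Longrightarrow> v $ i = 0" for v
    proof -
      have "v $ i = 0" for i
      proof -
        obtain j where "1 \<le> j" "j < a" "i = ?\<phi> j"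
          using bij_betw_imp_surj_on[OF bij] by (metis UNIV_I imageE atLeastLessThan_iff)
        then show ?thesis
          using determined[of "\<lambda>j. v $ ?\<phi> j" j] v 0 by auto
      qed
      then show ?thesis
        by (simp add: vec_eq_iff)
    qed
    show "\<exists>v\<in>?L. \<forall>i\<in>?\<phi> ` I. v $ i = c i" for c
    proof -
      obtain g where g: "ceil_additive a k g" "\<forall>i\<in>I. g i = c (?\<phi> i)"
        using free[of "\<lambda>i. c (?\<phi> i)"] by blast
      define v :: "real ^ 'm nonzero_residue" where "v = (\<chi> i. g (inv_into {1..<a} ?\<phi> i))"
      have v: "v $ ?\<phi> j = g j" if "1 \<le> j" "j < a" for j
        using that bij_betw_inv_into_left[OF bij] by (simp add: v_def)
      show ?thesis
      proof (rule bexI[of _ v])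
        show "v \<in> ?L"
          using g(1) by (simp add: ceil_additive_def v)
        show "\<forall>i\<in>?\<phi> ` I. v $ i = c i"
          using g(2) I v by auto
      qed
    qed
  qed
  also have "\<dots> = card I"
    using bij I by (intro card_image) (auto simp: bij_betw_def intro: inj_on_subset)
  finally show ?thesis
    using aff_dim_face_containing[OF a_card F] by simp
qed

section \<open>Dimensions for the four ranges of \<open>k\<close>\<close>

lemma aff_dim_face_max:
  fixes F :: "(real ^ 'm::nontriv nonzero_residue) set"
  assumes a_card: "a = int CARD('m)" and F: "face_contains F S" and "k = a - 1"
  shows "aff_dim F = a - 1"
proof -
  \<comment> \<open>Here \<open>i\<close>, \<open>j\<close> and \<open>i + j\<close> are all at most
    \<open>k\<close>, so the ceilings would require \<open>1 + 1 = 1\<close>: there are no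
    equations.\<close>
  have "ceil_additive a k g" for g
    unfolding ceil_additive_def using assms by (auto simp: ceil_div_eq_1)
  then have "aff_dim F = int (card {1..<a})"
    by (intro aff_dim_face_eq_card[OF a_card F]) auto
  then show ?thesis
    using a by simp
qed

lemma ceil_div_two: "i \<le> k \<Longrightarrow> j \<le> k \<Longrightarrow> k < i + j \<Longrightarrow> ceil_div (i + j) k = 2"
  using k by (intro ceil_div_eqI) auto

text \<open>The coordinates \<open>j\<close> and \<open>a - 1 - j\<close> sum to coordinate \<open>a - 1\<close>, and these are the only
  equations; hence one coordinate of each such pair is free, and so is coordinate \<open>a - 1\<close>.\<close>

lemma aff_dim_face_submax:
  fixes F :: "(real ^ 'm::nontriv nonzero_residue) set"
  assumes a_card: "a = int CARD('m)" and F: "face_contains F S" and ka: "k = a - 2"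
  shows "aff_dim F = a div 2"
proof -
  \<comment> \<open>The bound selects \<open>2 * j < a - 1\<close>. For odd \<open>a\<close> the
    middle index is paired with itself, so its value is half of that at \<open>a - 1\<close> and not
    free.\<close>
  define I where "I = insert (a - 1) {1..(a - 2) div 2}"
  have a3: "a \<ge> 3"
    using k ka by simp
  \<comment> \<open>Among the sums below \<open>a\<close>, only \<open>k + 1 = a - 1\<close> has
    ceiling 2, matching \<open>1 + 1\<close>.\<close>
  have tight: "1 \<le> i \<Longrightarrow> 1 \<le> j \<Longrightarrow> i + j < a \<Longrightarrow>
      ceil_div i k + ceil_div j k = ceil_div (i + j) k \<longleftrightarrow> i + j = a - 1" for i j
    using ceil_div_two[of i j] by (cases "i + j = a - 1") (auto simp: ceil_div_eq_1 ka)
  have "aff_dim F = int (card I)"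
  proof (rule aff_dim_face_eq_card[OF a_card F])
    show "I \<subseteq> {1..<a}"
      using a3 by (auto simp: I_def)
  next
    fix g j assume g: "ceil_additive a k g" "\<And>i. i \<in> I \<Longrightarrow> g i = 0" and j: "1 \<le> j" "j < a"
    show "g j = 0"
    proof (cases "j \<in> I")
      case False
      then have j': "j \<le> a - 2" "a - 1 \<le> 2 * j"
        using j by (auto simp: I_def)
      then have "g j + g (a - 1 - j) = g (a - 1)"
        using g(1) tight[of j "a - 1 - j"] j unfolding ceil_additive_def
        by (auto dest!: spec[of _ j] spec[of _ "a - 1 - j"])
      then have sum: "g j + g (a - 1 - j) = 0"
        using g(2) by (simp add: I_def)
      show ?thesis
      proof (cases "2 * j = a - 1")
        case True
        then have "a - 1 - j = j" by simp
        then show ?thesis using sum by simp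
      next
        case False
        then have "a - 1 - j \<in> I"
          using j' by (auto simp: I_def)
        then show ?thesis using sum g(2) by simp
      qed
    qed (use g in simp)
  next
    fix c :: "int \<Rightarrow> real"
    define g where "g j = (if j = a - 1 then c j else if 2 * j = a - 1 then c (a - 1) / 2
      else if 2 * j < a - 1 then c j else c (a - 1) - c (a - 1 - j))" for j
    have "g i + g j = g (i + j)" if "1 \<le> i" "1 \<le> j" "i + j = a - 1" for i j
    proof -
      have j: "j = a - 1 - i" using that by simp
      show ?thesis
        using that(1,2) unfolding j by (auto simp: g_def)
    qed
    then have "ceil_additive a k g"
      unfolding ceil_additive_def using tight by blast
    moreover have "\<forall>i\<in>I. g i = c i"
      by (auto simp: I_def g_def)
    ultimately show "\<exists>g. ceil_additive a k g \<and> (\<forall>i\<in>I. g i = c i)"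
      by blast
  qed
  moreover have "a - 1 \<notin> {1..(a - 2) div 2}"
    using a3 by auto
  ultimately show ?thesis
    using a3 by (simp add: I_def)
qed

text \<open>For \<open>k = 1\<close> the ceiling is the identity, so all equations with sum below
  \<open>a\<close> are present and \<open>g\<close> is the multiple of the index with factor
  \<open>g 1\<close>.\<close>

lemma aff_dim_face_min:
  fixes F :: "(real ^ 'm::nontriv nonzero_residue) set"
  assumes a_card: "a = int CARD('m)" and F: "face_contains F S" and "k = 1"
  shows "aff_dim F = 1"
proof -
  have "aff_dim F = int (card {1::int})"
  proof (rule aff_dim_face_eq_card[OF a_card F])
    fix g j assume g: "ceil_additive a k g" "\<And>i. i \<in> {1} \<Longrightarrow> g i = 0" and j: "1 \<le> j" "j < a"
    from j show "g j = 0"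
    proof (induction j rule: int_ge_induct)
      case (step j)
      have "g j + g 1 = g (j + 1)"
        using g(1) step.hyps step.prems \<open>k = 1\<close> by (simp add: ceil_additive_def ceil_div_def)
      then show ?case
        using step g(2) by simp
    qed (use g in simp)
  next
    show "\<exists>g. ceil_additive a k g \<and> (\<forall>i\<in>{1}. g i = c i)" for c
      by (intro exI[of _ "\<lambda>j. of_int j * c 1"]) (simp add: ceil_additive_def distrib_right)
  qed (use a in auto)
  then show ?thesis by simp
qed

text \<open>The equations with sums \<open>k + 1\<close> and \<open>k + 2\<close> force the first \<open>k\<close> coordinates into an
  arithmetic progression; these determine the remaining ones by adding coordinate \<open>k\<close>.\<close>

lemma aff_dim_face_mid:
  fixes F :: "(real ^ 'm::nontriv nonzero_residue) set"
  assumes a_card: "a = int CARD('m)" and F: "face_contains F S" and ka: "1 < k" "k < a - 2"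
  shows "aff_dim F = 2"
proof -
  have "aff_dim F = int (card {1, 2 :: int})"
  proof (rule aff_dim_face_eq_card[OF a_card F])
    fix g j assume g: "ceil_additive a k g" "\<And>i. i \<in> {1, 2} \<Longrightarrow> g i = 0" and j: "1 \<le> j" "j < a"
    have add: "g i + g j = g (i + j)" if "1 \<le> i" "i \<le> k" "1 \<le> j" "j \<le> k" "k < i + j" "i + j < a" for i j
      using g(1) that ceil_div_two[of i j] by (simp add: ceil_additive_def ceil_div_eq_1)
    \<comment> \<open>The two equations share the summand \<open>g (k + 1 - i)\<close>; the sum
      \<open>k + 2\<close> is admissible because \<open>k + 2 < a\<close>.\<close>
    have D: "g (i + 1) - g i = g (k + 2) - g (k + 1)" if "1 \<le> i" "i < k" for i
      using add[of i "k + 1 - i"] add[of "i + 1" "k + 1 - i"] that ka by (simp add: algebra_simps)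
    have D0: "g (k + 2) - g (k + 1) = 0"
      using D[of 1] g(2) ka by simp
    have small: "g i = 0" if "1 \<le> i" "i \<le> k" for i
      using that
    proof (induction i rule: int_ge_induct)
      case (step i)
      then show ?case using D[of i] D0 by simp
    qed (use g in simp)
    from j show "g j = 0"
    \<comment> \<open>Strong induction, since the index drops by \<open>k\<close> at a time.\<close>
    proof (induction "nat j" arbitrary: j rule: less_induct)
      case less
      show ?case
      proof (cases "j \<le> k")
        case False
        then have "g (j - k) = 0"
          using less.prems k by (intro less.hyps) auto
        moreover have "g (j - k) + g k = g j"
          using g(1) False less.prems k ceil_div_add_self[OF k_pos, of "j - k"]
          by (auto simp: ceil_additive_def ceil_div_eq_1 dest!: spec[of _ "j - k"] spec[of _ k])
        ultimately show ?thesis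
          using small[of k] k by simp
      qed (use small less.prems in simp)
    qed
  next
    fix c :: "int \<Rightarrow> real"
    \<comment> \<open>The maps \<open>j\<close> to \<open>ceil_div j k\<close> and \<open>j\<close>
      to \<open>j\<close> both solve the equations. As the ceiling is 1 at both 1 and 2, these
      coefficients give the prescribed values there.\<close>
    define g where "g j = of_int (ceil_div j k) * (2 * c 1 - c 2) + of_int j * (c 2 - c 1)" for j
    have "ceil_additive a k g"
      unfolding ceil_additive_def
    proof (intro allI impI)
      fix i j assume "ceil_div i k + ceil_div j k = ceil_div (i + j) k"
      then have "real_of_int (ceil_div (i + j) k) = of_int (ceil_div i k) + of_int (ceil_div j k)"
        by simp
      then show "g i + g j = g (i + j)"
        by (simp add: g_def algebra_simps)
    qed
    moreover have "g 1 = c 1" "g 2 = c 2"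
      using ka by (simp_all add: g_def ceil_div_eq_1)
    ultimately show "\<exists>g. ceil_additive a k g \<and> (\<forall>i\<in>{1, 2}. g i = c i)"
      by blast
  qed (use a ka in auto)
  then show ?thesis by simp
qed

end

theorem theorem4p2:
  fixes a h d k :: int and S :: "int set"
    and F :: "(real ^ 'm::nontriv nonzero_residue) set"
  assumes "a = int CARD('m)"
    and "extra_generalized_arithmetical a h d k S"
    and "minimally_generating (ega_generators a h d k)"
    and "face_contains F S"
  shows "(k = a - 1 \<longrightarrow> aff_dim F = a - 1) \<and>
         (k = a - 2 \<longrightarrow> aff_dim F = \<lfloor>real_of_int a / 2\<rfloor>) \<and>
         (1 < k \<and> k < a - 2 \<longrightarrow> aff_dim F = 2) \<and>
         (k = 1 \<longrightarrow> aff_dim F = 1)"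
proof -
  interpret minimal_ega a h d k S
    using assms(2,3) by unfold_locales
  have "\<lfloor>real_of_int a / 2\<rfloor> = a div 2"
    using floor_divide_of_int_eq[of a 2] by simp
  then show ?thesis
    using aff_dim_face_max aff_dim_face_submax aff_dim_face_mid aff_dim_face_min assms(1,4)
    by metis
qed

end
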